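(* Let $(\Omega,\mathcal F)$ be a measurable space, $\mathcal G\subseteq\mathcal F$ a sub-$\sigma$-algebra, and let $c:\mathcal F\to[0,1]$ be a capacity which is continuous from below. Assume that there exists a real-valued $\mathcal F$-measurable function $Z$ whose distribution function $G_Z$ with respect to $c$ is continuous and satisfies $\lim_{x\to-\infty}G_Z(x)=0$ and $\lim_{x\to+\infty}G_Z(x)=1$. Let $\phi^{\mathcal G}$ be a $\mathcal G$-random distortion function. If $X,Y\in\chi(\mathcal F)$ are comonotonic, then $$\mathbb E_{\phi^{\mathcal G}\circ c}(X+Y)=\mathbb E_{\phi^{\mathcal G}\circ c}(X)+\mathbb E_{\phi^{\mathcal G}\circ c}(Y).$$
   Context: $\chi(\mathcal F)$ is the set of all bounded real-valued $\mathcal F$-measurable functions on $\Omega$. Equality of functions is pointwise for all $\omega\in\Omega$. A capacity on $(\Omega,\mathcal F)$ is a set function $c:\mathcal F\to[0,1]$ with $c(\emptyset)=0$, $c(\Omega)=1$, and $c(A)\le c(B)$ whenever $A\subset B$, $A,B\in\mathcal F$. It is continuous from below if $\lim_n c(A_n)=c(\bigcup_n A_n)$ for every sequence $(A_n)$ in $\mathcal F$ with $A_n\subset A_{n+1}$ for all $n$. The distribution function of a real-valued measurable $X$ with respect to $c$ is $G_X(x):=1-c(X>x)$, $x\in\mathbb R$. A $\mathcal G$-random distortion function is a map $\phi^{\mathcal G}:\Omega\times[0,1]\to[0,1]$ such that for every $\omega\in\Omega$ the function $t\mapsto\phi^{\mathcal G}(\omega,t)$ is non-decreasing with $\phi^{\mathcal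 G}(\omega,0)=0$, $\phi^{\mathcal G}(\omega,1)=1$, and for every $t\in[0,1]$ the function $\omega\mapsto\phi^{\mathcal G}(\omega,t)$ is $\mathcal G$-measurable. The $\mathcal G$-randomly distorted Choquet integral of $X\in\chi(\mathcal F)$ is defined, for all $\omega\in\Omega$, by $$\mathbb E_{\phi^{\mathcal G}\circ c}(X)(\omega)=\int_0^{+\infty}\phi^{\mathcal G}(\omega,c(X>x))\,dx+\int_{-\infty}^0[\phi^{\mathcal G}(\omega,c(X>x))-1]\,dx.$$ $X$ and $Y$ are comonotonic if $(X(\omega)-X(\bar\omega))(Y(\omega)-Y(\bar\omega))\ge0$ for all $(\omega,\bar\omega)\in\Omega\times\Omega$. *)

theory Defs
  imports "HOL-Probability.Conditional_Expectation"
begin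

(* A measurable space is represented by a value of type 'a measure, of which only
   space M and sets M are used; its emeasure plays no role. *)

definition capacity :: "'a measure \<Rightarrow> ('a set \<Rightarrow> real) \<Rightarrow> bool" where
  "capacity M c \<longleftrightarrow>
     (\<forall>A\<in>sets M. c A \<in> {0..1}) \<and> c {} = 0 \<and> c (space M) = 1 \<and>
     (\<forall>A\<in>sets M. \<forall>B\<in>sets M. A \<subseteq> B \<longrightarrow> c A \<le> c B)"

definition continuous_from_below :: "'a measure \<Rightarrow> ('a set \<Rightarrow> real) \<Rightarrow> bool" where
  "continuous_from_below M c \<longleftrightarrow>
     (\<forall>A :: nat \<Rightarrow> 'a set. range A \<subseteq> sets M \<longrightarrow> (\<forall>n. A n \<subseteq> A (Suc n)) \<longrightarrow>
        (\<lambda>n. c (A n)) \<longlonglongrightarrow> c (\<Union>n. A n))"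

definition distribution_function ::
    "'a measure \<Rightarrow> ('a set \<Rightarrow> real) \<Rightarrow> ('a \<Rightarrow> real) \<Rightarrow> real \<Rightarrow> real" where
  "distribution_function M c X x = 1 - c {w \<in> space M. X w > x}"

definition bounded_measurable :: "'a measure \<Rightarrow> ('a \<Rightarrow> real) set" where
  "bounded_measurable M = {X \<in> borel_measurable M. bounded (X ` space M)}"

(* Values of phi outside space G \<times> {0..1} are irrelevant. *)
definition random_distortion :: "'a measure \<Rightarrow> ('a \<Rightarrow> real \<Rightarrow> real) \<Rightarrow> bool" where
  "random_distortion G \<phi> \<longleftrightarrow>
     (\<forall>w\<in>space G. (\<forall>t\<in>{0..1}. \<phi> w t \<in> {0..1}) \<and>
        mono_on {0..1} (\<phi> w) \<and> \<phi> w 0 = 0 \<and> \<phi> w 1 = 1) \<and>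
     (\<forall>t\<in>{0..1}. (\<lambda>w. \<phi> w t) \<in> borel_measurable G)"

(* For X in bounded_measurable M the integrands are, at each w in space M, bounded, monotone
   and of bounded support on their half-lines, so both Lebesgue integrals are finite and the
   convention that non-integrable functions have integral 0 is never used. *)
definition distorted_choquet ::
    "'a measure \<Rightarrow> ('a \<Rightarrow> real \<Rightarrow> real) \<Rightarrow> ('a set \<Rightarrow> real) \<Rightarrow> ('a \<Rightarrow> real) \<Rightarrow> 'a \<Rightarrow> real" where
  "distorted_choquet M \<phi> c X w =
     (LINT x:{0..}|lborel. \<phi> w (c {v \<in> space M. X v > x})) +
     (LINT x:{..0}|lborel. (\<phi> w (c {v \<in> space M. X v > x}) - 1))"

definition comonotonic :: "'a measure \<Rightarrow> ('a \<Rightarrow> real) \<Rightarrow> ('a \<Rightarrow> real) \<Rightarrow> bool" where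
  "comonotonic M X Y \<longleftrightarrow>
     (\<forall>w\<in>space M. \<forall>v\<in>space M. (X w - X v) * (Y w - Y v) \<ge> 0)"

end

theory Submission
  imports Defs
begin

text \<open>
  Fix \<open>w\<close>. The set function \<open>\<nu> A = \<phi> w (c A)\<close> is monotone with \<open>\<nu> {} = 0\<close> and \<open>\<nu> (space M) = 1\<close>,
  and \<open>distorted_choquet\<close> at \<open>w\<close> is the Choquet integral with respect to \<open>\<nu>\<close>. By Fubini it is the
  integral over \<open>t \<in> (0, 1)\<close> of the upper quantile \<open>Q X t = Sup {x. \<nu> (X > x) > t}\<close>.
  Upper level sets of comonotonic \<open>X\<close>, \<open>Y\<close> are nested, so \<open>\<nu>\<close> of the intersection (union) of
  \<open>{X > x}\<close> and \<open>{Y > y}\<close> is the minimum (maximum) of the two values, which gives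
  \<open>Q (X + Y) t = Q X t + Q Y t\<close> for every \<open>t\<close>.
\<close>

section \<open>Bounded survival functions and their quantiles\<close>

lemma borel_measurable_antimono_real:
  fixes h :: "real \<Rightarrow> real"
  assumes "antimono h"
  shows "h \<in> borel_measurable borel"
proof -
  have "mono (\<lambda>x. - h x)"
    using assms by (auto simp: mono_def antimono_def)
  then have "(\<lambda>x. - h x) \<in> borel_measurable borel"
    by (rule borel_measurable_mono)
  then have "(\<lambda>x. - (- h x)) \<in> borel_measurable borel"
    by (rule borel_measurable_uminus)
  then show ?thesis
    by simp
qed

text \<open>A generalised inverse of a decreasing \<open>h\<close>. The \<open>Sup\<close> is
  informative only for a nonempty set that is bounded above; in the locale below this is the case
  for every \<open>t\<close> strictly between 0 and 1.\<close>

definition upper_quantile :: "(real \<Rightarrow> real) \<Rightarrow> real \<Rightarrow> real" where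
  "upper_quantile h t = Sup {x. t < h x}"

text \<open>Models \<open>\<nu> (X > x)\<close> for \<open>X\<close> with values in
  \<open>{- K..K}\<close>. The level sets are strict, so at \<open>K\<close> the set is already
  empty, whereas at \<open>- K\<close> it may miss the points where \<open>X\<close> equals
  \<open>- K\<close>; hence \<open><\<close> on one side and \<open>\<ge>\<close> on the
  other.\<close>

locale survival_function =
  fixes h :: "real \<Rightarrow> real" and K :: real
  assumes antimono: "antimono h"
    and nonneg: "\<And>x. 0 \<le> h x"
    and le_one: "\<And>x. h x \<le> 1"
    and eq_one: "\<And>x. x < - K \<Longrightarrow> h x = 1"
    and eq_zero: "\<And>x. x \<ge> K \<Longrightarrow> h x = 0"
    and K_nonneg: "K \<ge> 0"
begin

lemma measurable [measurable]: "h \<in> borel_measurable borel"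
  by (rule borel_measurable_antimono_real[OF antimono])

text \<open>Only points strictly below or strictly above the quantile are treated, here and in
  \<open>quantile_less\<close>: \<open>h\<close> may jump there, and its value at the quantile can
  lie on either side of \<open>t\<close>.\<close>

lemma less_quantile:
  assumes "0 < t" "t < 1" "x < upper_quantile h t"
  shows "t < h x"
proof -
  \<comment> \<open>A point where \<open>h\<close> equals 1, so the set under the supremum is
    nonempty.\<close>
  have "- K - 1 \<in> {x. t < h x}"
    using assms eq_one[of "- K - 1"] by simp
  then obtain y where "t < h y" "x < y"
    using less_cSupD[of "{x. t < h x}" x] assms(3) unfolding upper_quantile_def by auto
  then show ?thesis
    using antimonoD[OF antimono, of x y] by simp
qed

lemma quantile_less:
  assumes "0 < t" "upper_quantile h t < x"
  shows "h x \<le> t"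
proof (rule ccontr)
  assume "\<not> h x \<le> t"
  then have "x \<in> {x. t < h x}" by simp
  moreover have "bdd_above {x. t < h x}"
  proof (rule bdd_aboveI[of _ K])
    fix y assume "y \<in> {x. t < h x}"
    then show "y \<le> K"
      using eq_zero[of y] assms(1) by fastforce
  qed
  ultimately have "x \<le> upper_quantile h t"
    unfolding upper_quantile_def by (rule cSup_upper)
  then show False using assms(2) by simp
qed

lemma quantile_bounds:
  assumes "0 < t" "t < 1"
  shows "- K \<le> upper_quantile h t" "upper_quantile h t \<le> K"
proof -
  show "- K \<le> upper_quantile h t"
  proof (rule ccontr)
    assume "\<not> - K \<le> upper_quantile h t"
    then obtain x where "upper_quantile h t < x" "x < - K"
      using dense not_le by metis
    then show False
      using quantile_less[of t x] eq_one[of x] assms by simp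
  qed
  show "upper_quantile h t \<le> K"
    using less_quantile[of t K] eq_zero[of K] assms by fastforce
qed

text \<open>If \<open>q\<close> differed from the quantile, the midpoint of the two would violate
  one of the \<open>e\<close>-conditions. This identifies a quantile without evaluating
  \<open>h\<close> at it.\<close>

lemma quantile_eqI:
  assumes "0 < t" "t < 1"
    and "\<And>e. e > 0 \<Longrightarrow> t < h (q - e)"
    and "\<And>e. e > 0 \<Longrightarrow> h (q + e) \<le> t"
  shows "upper_quantile h t = q"
proof (rule ccontr)
  assume "upper_quantile h t \<noteq> q"
  then consider "upper_quantile h t < q" | "q < upper_quantile h t" by linarith
  then show False
  proof cases
    case 1
    define e where "e = (q - upper_quantile h t) / 2"
    show False
      using assms(3)[of e] quantile_less[of t "q - e"] assms(1) 1 by (simp add: e_def field_simps)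
  next
    case 2
    define e where "e = (upper_quantile h t - q) / 2"
    show False
      using assms(4)[of e] less_quantile[of t "q + e"] assms(1,2) 2 by (simp add: e_def field_simps)
  qed
qed

section \<open>The Choquet integral as an integral of quantiles\<close>

lemma emeasure_superlevel:
  assumes "0 < t" "t < 1"
  shows "emeasure lborel {x \<in> {- K..K}. t < h x} = ennreal (upper_quantile h t + K)"
proof (rule antisym)
  \<comment> \<open>The superlevel set lies between a half-open and a closed interval with the same
    endpoints, hence of the same length.\<close>
  have "{x \<in> {- K..K}. t < h x} \<subseteq> {- K..upper_quantile h t}"
    using quantile_less[OF assms(1)] by (fastforce intro: leI dest: less_le_trans)
  then have "emeasure lborel {x \<in> {- K..K}. t < h x} \<le> emeasure lborel {- K..upper_quantile h t}"
    by (rule emeasure_mono) simp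
  then show "emeasure lborel {x \<in> {- K..K}. t < h x} \<le> ennreal (upper_quantile h t + K)"
    using quantile_bounds[OF assms] by simp
  have "{- K..<upper_quantile h t} \<subseteq> {x \<in> {- K..K}. t < h x}"
    using less_quantile[OF assms] quantile_bounds[OF assms] by auto
  then have "emeasure lborel {- K..<upper_quantile h t} \<le> emeasure lborel {x \<in> {- K..K}. t < h x}"
    by (rule emeasure_mono) measurable
  then show "ennreal (upper_quantile h t + K) \<le> emeasure lborel {x \<in> {- K..K}. t < h x}"
    using quantile_bounds[OF assms] by simp
qed

text \<open>Since \<open>0 \<le> h x \<le> 1\<close>, the value \<open>h x\<close> is the length of
  the set of \<open>t\<close> in \<open>{0<..<1}\<close> below \<open>h x\<close>; exchanging the
  two integrals gives the claim.\<close>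

lemma layer_cake:
  "(\<integral>\<^sup>+x\<in>{- K..K}. ennreal (h x) \<partial>lborel) =
     (\<integral>\<^sup>+t\<in>{0<..<1}. emeasure lborel {x \<in> {- K..K}. t < h x} \<partial>lborel)"
proof -
  let ?f = "\<lambda>x t. indicator {- K..K} x * indicator {0<..<1} t * indicator {p. snd p < h (fst p)} (x, t) :: ennreal"
  have "{p \<in> space (borel \<Otimes>\<^sub>M borel). snd p < h (fst p)} \<in> sets (borel \<Otimes>\<^sub>M borel)"
    by measurable
  then have [measurable]: "{p. snd p < h (fst p)} \<in> sets (borel \<Otimes>\<^sub>M borel)"
    by (simp add: space_pair_measure)
  have "(\<integral>\<^sup>+x\<in>{- K..K}. ennreal (h x) \<partial>lborel) = (\<integral>\<^sup>+x. \<integral>\<^sup>+t. ?f x t \<partial>lborel \<partial>lborel)"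
  proof (rule nn_integral_cong)
    fix x :: real
    have "(\<integral>\<^sup>+t. ?f x t \<partial>lborel) =
        (\<integral>\<^sup>+t. indicator {- K..K} x * indicator {0<..<h x} t \<partial>lborel)"
      using le_one[of x] by (intro nn_integral_cong) (auto simp: indicator_def)
    also have "\<dots> = indicator {- K..K} x * ennreal (h x)"
      using nonneg[of x] by (simp add: nn_integral_cmult)
    finally show "ennreal (h x) * indicator {- K..K} x = (\<integral>\<^sup>+t. ?f x t \<partial>lborel)"
      by (simp add: mult.commute)
  qed
  also have "\<dots> = (\<integral>\<^sup>+t. \<integral>\<^sup>+x. ?f x t \<partial>lborel \<partial>lborel)"
    by (rule lborel_pair.Fubini') measurable
  also have "\<dots> = (\<integral>\<^sup>+t\<in>{0<..<1}. emeasure lborel {x \<in> {- K..K}. t < h x} \<partial>lborel)"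
  proof (rule nn_integral_cong)
    fix t :: real
    have "(\<integral>\<^sup>+x. ?f x t \<partial>lborel) =
        (\<integral>\<^sup>+x. indicator {0<..<1} t * indicator {x \<in> {- K..K}. t < h x} x \<partial>lborel)"
      by (intro nn_integral_cong) (auto simp: indicator_def)
    also have "\<dots> = indicator {0<..<1} t * emeasure lborel {x \<in> {- K..K}. t < h x}"
      by (subst nn_integral_cmult_indicator) measurable
    finally show "(\<integral>\<^sup>+x. ?f x t \<partial>lborel) =
        emeasure lborel {x \<in> {- K..K}. t < h x} * indicator {0<..<1} t"
      by (simp add: mult.commute)
  qed
  finally show ?thesis .
qed

text \<open>The lengths of the sections of a measurable subset of the plane depend measurably on the
  section. This allows the integral of a sum to be split in \<open>choquet_add\<close>.\<close>

lemma superlevel_measurable: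
  "(\<lambda>t. emeasure lborel {x \<in> {- K..K}. t < h x}) \<in> borel_measurable borel"
proof -
  have "{p \<in> space (borel \<Otimes>\<^sub>M lborel). snd p \<in> {- K..K} \<and> fst p < h (snd p)}
      \<in> sets (borel \<Otimes>\<^sub>M lborel)"
    by measurable
  then have "{p. snd p \<in> {- K..K} \<and> fst p < h (snd p)} \<in> sets (borel \<Otimes>\<^sub>M lborel)"
    by (simp add: space_pair_measure)
  from lborel.measurable_emeasure_Pair[OF this] show ?thesis
    by (simp add: vimage_def)
qed

lemma nn_integral_finite: "(\<integral>\<^sup>+x\<in>{- K..K}. ennreal (h x) \<partial>lborel) < \<infinity>"
proof -
  have "(\<integral>\<^sup>+x\<in>{- K..K}. ennreal (h x) \<partial>lborel) \<le> (\<integral>\<^sup>+x. indicator {- K..K} x \<partial>lborel)"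
    using le_one by (intro nn_integral_mono) (auto simp: indicator_def)
  also have "\<dots> < \<infinity>"
    using K_nonneg by simp
  finally show ?thesis .
qed

lemma set_integrable_Icc: "set_integrable lborel {a..b} h"
proof (cases "a \<le> b")
  case True
  have "integrable lborel (\<lambda>x. indicator {a..b} x :: real)"
    using True by simp
  then show ?thesis
    unfolding set_integrable_def
    by (rule Bochner_Integration.integrable_bound) (use nonneg le_one in \<open>auto simp: indicator_def\<close>)
qed (simp add: set_integrable_def)

text \<open>Both integrands vanish outside \<open>{- K..K}\<close>, and the constant
  \<open>- 1\<close> integrated over \<open>{- K..0}\<close> yields \<open>- K\<close>. The signed
  integral thus becomes a nonnegative one with a fixed offset.\<close>

lemma choquet_eq:
  "(LINT x:{0..}|lborel. h x) + (LINT x:{..0}|lborel. (h x - 1)) =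
     enn2real (\<integral>\<^sup>+x\<in>{- K..K}. ennreal (h x) \<partial>lborel) - K"
proof -
  have "(LINT x:{0..}|lborel. h x) = (LINT x:{0..K}|lborel. h x)"
    unfolding set_lebesgue_integral_def
    by (intro Bochner_Integration.integral_cong) (use eq_zero in \<open>auto simp: indicator_def\<close>)
  moreover have "(LINT x:{..0}|lborel. (h x - 1)) = (LINT x:{- K..0}|lborel. (h x - 1))"
    unfolding set_lebesgue_integral_def
    by (intro Bochner_Integration.integral_cong) (use eq_one in \<open>auto simp: indicator_def\<close>)
  moreover have "(LINT x:{- K..0}|lborel. (h x - 1)) = (LINT x:{- K..0}|lborel. h x) - K"
  proof -
    have "set_integrable lborel {- K..0} (\<lambda>x. 1 :: real)"
      using K_nonneg by (simp add: set_integrable_def)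
    then show ?thesis
      using K_nonneg by (subst set_integral_diff(2)[OF set_integrable_Icc]) (auto simp: set_lebesgue_integral_def)
  qed
  moreover have "(LINT x:{- K..K}|lborel. h x) = (LINT x:{- K..0}|lborel. h x) + (LINT x:{0..K}|lborel. h x)"
  proof -
    have "{- K..K} = {- K..0} \<union> {0..K}"
      using K_nonneg by auto
    \<comment> \<open>The two intervals share only the null set \<open>{0}\<close>.\<close>
    moreover have "AE x in lborel. \<not> (x \<in> {- K..0} \<and> x \<in> {0..K})"
      using AE_lborel_singleton[of 0] by eventually_elim auto
    ultimately show ?thesis
      using set_integral_Un_AE[of "{- K..0}" "{0..K}" lborel h]
      by (simp add: set_integrable_Icc)
  qed
  moreover have "(LINT x:{- K..K}|lborel. h x) = enn2real (\<integral>\<^sup>+x\<in>{- K..K}. ennreal (h x) \<partial>lborel)"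
    unfolding set_lebesgue_integral_def
    by (subst integral_eq_nn_integral)
       (auto simp: nonneg indicator_def intro!: arg_cong[of _ _ enn2real] nn_integral_cong)
  ultimately show ?thesis
    by simp
qed

end

text \<open>Taking \<open>K + L\<close> as the bound for \<open>h\<close> makes the offsets from
  \<open>choquet_eq\<close> cancel.\<close>

lemma choquet_add:
  assumes "survival_function f K" "survival_function g L" "survival_function h (K + L)"
    and quantile: "\<And>t. 0 < t \<Longrightarrow> t < 1 \<Longrightarrow> upper_quantile h t = upper_quantile f t + upper_quantile g t"
  shows "(LINT x:{0..}|lborel. h x) + (LINT x:{..0}|lborel. (h x - 1)) =
     ((LINT x:{0..}|lborel. f x) + (LINT x:{..0}|lborel. (f x - 1))) +
     ((LINT x:{0..}|lborel. g x) + (LINT x:{..0}|lborel. (g x - 1)))"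
proof -
  interpret f: survival_function f K by fact
  interpret g: survival_function g L by fact
  interpret h: survival_function h "K + L" by fact
  note [measurable] = f.superlevel_measurable g.superlevel_measurable
  have "(\<integral>\<^sup>+x\<in>{- (K + L)..K + L}. ennreal (h x) \<partial>lborel) =
    (\<integral>\<^sup>+t. (emeasure lborel {x \<in> {- K..K}. t < f x} * indicator {0<..<1} t +
           emeasure lborel {x \<in> {- L..L}. t < g x} * indicator {0<..<1} t) \<partial>lborel)"
    unfolding h.layer_cake
  proof (rule nn_integral_cong)
    fix t :: real
    show "emeasure lborel {x \<in> {- (K + L)..K + L}. t < h x} * indicator {0<..<1} t =
      emeasure lborel {x \<in> {- K..K}. t < f x} * indicator {0<..<1} t +
      emeasure lborel {x \<in> {- L..L}. t < g x} * indicator {0<..<1} t"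
    proof (cases "0 < t \<and> t < 1")
      case True
      then have t: "0 < t" "t < 1" by auto
      show ?thesis
        \<comment> \<open>The bounds make both shifted quantiles nonnegative, as additivity of
          \<open>ennreal\<close> requires.\<close>
        using f.quantile_bounds[OF t] g.quantile_bounds[OF t] t
        unfolding h.emeasure_superlevel[OF t] f.emeasure_superlevel[OF t] g.emeasure_superlevel[OF t] quantile[OF t]
        by (simp add: ennreal_plus[symmetric] algebra_simps del: ennreal_plus)
    qed simp
  qed
  also have "\<dots> = (\<integral>\<^sup>+x\<in>{- K..K}. ennreal (f x) \<partial>lborel) + (\<integral>\<^sup>+x\<in>{- L..L}. ennreal (g x) \<partial>lborel)"
    unfolding f.layer_cake g.layer_cake by (rule nn_integral_add) measurable
  finally show ?thesis
    unfolding f.choquet_eq g.choquet_eq h.choquet_eq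
    \<comment> \<open>\<open>enn2real\<close> sends infinity to 0, so it is additive here only
      thanks to finiteness.\<close>
    using f.nn_integral_finite g.nn_integral_finite by (simp add: enn2real_plus)
qed

section \<open>Level sets of bounded and of comonotonic functions\<close>

lemma survival_function_level_sets:
  fixes \<nu> :: "'a set \<Rightarrow> real"
  assumes mono: "\<And>A B. A \<in> sets M \<Longrightarrow> B \<in> sets M \<Longrightarrow> A \<subseteq> B \<Longrightarrow> \<nu> A \<le> \<nu> B"
    and "\<nu> {} = 0" "\<nu> (space M) = 1"
    and [measurable]: "X \<in> borel_measurable M"
    and bound: "\<And>v. v \<in> space M \<Longrightarrow> \<bar>X v\<bar> \<le> K" and "K \<ge> 0"
  shows "survival_function (\<lambda>x. \<nu> {v \<in> space M. X v > x}) K"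
proof
  show "antimono (\<lambda>x. \<nu> {v \<in> space M. X v > x})"
    by (intro antimonoI mono) auto
  fix x :: real
  show "0 \<le> \<nu> {v \<in> space M. X v > x}"
    using mono[of "{}" "{v \<in> space M. X v > x}"] assms(2) by simp
  show "\<nu> {v \<in> space M. X v > x} \<le> 1"
    using mono[of "{v \<in> space M. X v > x}" "space M"] assms(3) by auto
  show "\<nu> {v \<in> space M. X v > x} = 1" if "x < - K"
  proof -
    have *: "{v \<in> space M. X v > x} = space M" using bound that by fastforce
    show ?thesis unfolding * by fact
  qed
  show "\<nu> {v \<in> space M. X v > x} = 0" if "x \<ge> K"
  proof -
    have *: "{v \<in> space M. X v > x} = {}" using bound that by fastforce
    show ?thesis unfolding * by fact
  qed
qed fact

text \<open>A point \<open>u\<close> in the first set only and a point \<open>v\<close> in the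
  second only would give \<open>X u > X v\<close> and \<open>Y u < Y v\<close>, a negative
  product.\<close>

lemma comonotonic_level_sets_nested:
  assumes "comonotonic M X Y"
  shows "{v \<in> space M. X v > x} \<subseteq> {v \<in> space M. Y v > y} \<or>
         {v \<in> space M. Y v > y} \<subseteq> {v \<in> space M. X v > x}"
proof (rule ccontr)
  assume "\<not> ?thesis"
  then obtain u v where "u \<in> {v \<in> space M. X v > x}" "u \<notin> {v \<in> space M. Y v > y}"
    and "v \<in> {v \<in> space M. Y v > y}" "v \<notin> {v \<in> space M. X v > x}"
    by blast
  then show False
    using assms mult_pos_neg[of "X u - X v" "Y u - Y v"]
    unfolding comonotonic_def by fastforce
qed

lemma upper_quantile_add_comonotonic:
  fixes \<nu> :: "'a set \<Rightarrow> real" and M :: "'a measure"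
  defines "S \<equiv> \<lambda>X x. \<nu> {v \<in> space M. X v > x}"
  assumes mono: "\<And>A B. A \<in> sets M \<Longrightarrow> B \<in> sets M \<Longrightarrow> A \<subseteq> B \<Longrightarrow> \<nu> A \<le> \<nu> B"
    and [measurable]: "X \<in> borel_measurable M" "Y \<in> borel_measurable M"
    and como: "comonotonic M X Y"
    and "survival_function (S X) K" "survival_function (S Y) L"
      "survival_function (S (\<lambda>v. X v + Y v)) N"
    and t: "0 < t" "t < 1"
  shows "upper_quantile (S (\<lambda>v. X v + Y v)) t = upper_quantile (S X) t + upper_quantile (S Y) t"
proof -
  interpret X: survival_function "S X" K by fact
  interpret Y: survival_function "S Y" L by fact
  interpret Z: survival_function "S (\<lambda>v. X v + Y v)" N by fact
  let ?A = "\<lambda>x. {v \<in> space M. X v > x}" and ?B = "\<lambda>x. {v \<in> space M. Y v > x}"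
  let ?C = "\<lambda>x. {v \<in> space M. X v + Y v > x}"
  let ?a = "upper_quantile (S X) t" and ?b = "upper_quantile (S Y) t"
  \<comment> \<open>For nested sets the intersection and the union are each one of the two
    sets.\<close>
  have inter: "t < \<nu> (A \<inter> B)" if "A \<subseteq> B \<or> B \<subseteq> A" "t < \<nu> A" "t < \<nu> B" for A B
    using that by (auto simp: Int_absorb1 Int_absorb2)
  have union: "\<nu> (A \<union> B) \<le> t" if "A \<subseteq> B \<or> B \<subseteq> A" "\<nu> A \<le> t" "\<nu> B \<le> t" for A B
    using that by (auto simp: Un_absorb1 Un_absorb2)
  show ?thesis
  proof (rule Z.quantile_eqI[OF t])
    fix e :: real assume e: "e > 0"
    \<comment> \<open>Each summand gets half of \<open>e\<close>: two lower bounds that hold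
      together add up to one for the sum.\<close>
    have "t < \<nu> (?A (?a - e/2) \<inter> ?B (?b - e/2))"
    proof (rule inter[OF comonotonic_level_sets_nested[OF como]])
      show "t < \<nu> (?A (?a - e/2))"
        using X.less_quantile[OF t, of "?a - e/2"] e by (simp add: S_def)
      show "t < \<nu> (?B (?b - e/2))"
        using Y.less_quantile[OF t, of "?b - e/2"] e by (simp add: S_def)
    qed
    also have "\<dots> \<le> \<nu> (?C (?a + ?b - e))"
    proof (rule mono)
      show "?A (?a - e/2) \<inter> ?B (?b - e/2) \<subseteq> ?C (?a + ?b - e)"
        by (auto simp: field_simps)
    qed measurable
    finally show "t < S (\<lambda>v. X v + Y v) (?a + ?b - e)"
      by (simp add: S_def)
    \<comment> \<open>Dually, a sum above \<open>?a + ?b + e\<close> forces one summand above its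
      own threshold.\<close>
    have "\<nu> (?C (?a + ?b + e)) \<le> \<nu> (?A (?a + e/2) \<union> ?B (?b + e/2))"
    proof (rule mono)
      show "?C (?a + ?b + e) \<subseteq> ?A (?a + e/2) \<union> ?B (?b + e/2)"
        by (auto simp: field_simps)
    qed measurable
    also have "\<dots> \<le> t"
    proof (rule union[OF comonotonic_level_sets_nested[OF como]])
      show "\<nu> (?A (?a + e/2)) \<le> t"
        using X.quantile_less[OF t(1), of "?a + e/2"] e by (simp add: S_def)
      show "\<nu> (?B (?b + e/2)) \<le> t"
        using Y.quantile_less[OF t(1), of "?b + e/2"] e by (simp add: S_def)
    qed
    finally show "S (\<lambda>v. X v + Y v) (?a + ?b + e) \<le> t"
      by (simp add: S_def)
  qed
qed

theorem theorem1:
  fixes M G :: "'a measure"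
    and c :: "'a set \<Rightarrow> real"
    and \<phi> :: "'a \<Rightarrow> real \<Rightarrow> real"
    and X Y :: "'a \<Rightarrow> real"
  assumes "subalgebra M G"
    and "capacity M c"
    and "continuous_from_below M c"
    and "\<exists>Z \<in> borel_measurable M.
           continuous_on UNIV (distribution_function M c Z) \<and>
           (distribution_function M c Z \<longlongrightarrow> 0) at_bot \<and>
           (distribution_function M c Z \<longlongrightarrow> 1) at_top"
    and "random_distortion G \<phi>"
    and "X \<in> bounded_measurable M"
    and "Y \<in> bounded_measurable M"
    and "comonotonic M X Y"
  shows "\<forall>w\<in>space M. distorted_choquet M \<phi> c (\<lambda>v. X v + Y v) w =
           distorted_choquet M \<phi> c X w + distorted_choquet M \<phi> c Y w"
proof
  fix w assume w: "w \<in> space M"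
  define \<nu> where "\<nu> A = \<phi> w (c A)" for A
  have "w \<in> space G"
    using w \<open>subalgebra M G\<close> by (simp add: subalgebra_def)
  then have \<phi>: "mono_on {0..1} (\<phi> w)" "\<phi> w 0 = 0" "\<phi> w 1 = 1"
    using \<open>random_distortion G \<phi>\<close> by (auto simp: random_distortion_def)
  have mono: "\<nu> A \<le> \<nu> B" if "A \<in> sets M" "B \<in> sets M" "A \<subseteq> B" for A B
    using \<open>capacity M c\<close> that unfolding \<nu>_def capacity_def
    by (intro mono_onD[OF \<phi>(1)]) auto
  have \<nu>: "\<nu> {} = 0" "\<nu> (space M) = 1"
    using \<open>capacity M c\<close> \<phi> by (auto simp: \<nu>_def capacity_def)
  have meas [measurable]: "X \<in> borel_measurable M" "Y \<in> borel_measurable M"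
    using assms by (auto simp: bounded_measurable_def)
  obtain K where K: "\<And>v. v \<in> space M \<Longrightarrow> \<bar>X v\<bar> \<le> K"
    using \<open>X \<in> bounded_measurable M\<close> by (auto simp: bounded_measurable_def bounded_iff)
  obtain L where L: "\<And>v. v \<in> space M \<Longrightarrow> \<bar>Y v\<bar> \<le> L"
    using \<open>Y \<in> bounded_measurable M\<close> by (auto simp: bounded_measurable_def bounded_iff)
  \<comment> \<open>The point \<open>w\<close> lies in the space, so each bound dominates an
    absolute value.\<close>
  have pos: "K \<ge> 0" "L \<ge> 0"
    using K[OF w] L[OF w] by auto
  note surv = survival_function_level_sets[of M \<nu>, OF mono \<nu>]
  have X: "survival_function (\<lambda>x. \<nu> {v \<in> space M. X v > x}) K"
    using K pos by (intro surv) auto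
  have Y: "survival_function (\<lambda>x. \<nu> {v \<in> space M. Y v > x}) L"
    using L pos by (intro surv) auto
  have "\<bar>X v + Y v\<bar> \<le> K + L" if "v \<in> space M" for v
    using K[OF that] L[OF that] by linarith
  then have Z: "survival_function (\<lambda>x. \<nu> {v \<in> space M. X v + Y v > x}) (K + L)"
    using pos by (intro surv) auto
  have "upper_quantile (\<lambda>x. \<nu> {v \<in> space M. X v + Y v > x}) t =
      upper_quantile (\<lambda>x. \<nu> {v \<in> space M. X v > x}) t + upper_quantile (\<lambda>x. \<nu> {v \<in> space M. Y v > x}) t"
    if "0 < t" "t < 1" for t
    by (rule upper_quantile_add_comonotonic[where M = M and \<nu> = \<nu> and X = X and Y = Y,
          OF mono meas \<open>comonotonic M X Y\<close> X Y Z that])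
  then show "distorted_choquet M \<phi> c (\<lambda>v. X v + Y v) w =
      distorted_choquet M \<phi> c X w + distorted_choquet M \<phi> c Y w"
    unfolding distorted_choquet_def \<nu>_def[symmetric] by (rule choquet_add[OF X Y Z])
qed

end
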